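(* Let $F$ be a topological space, $(Y,d_Y)$ a metric space, and $S\colon F\to Y$ any mapping. Then for every integer $n\ge 2$, \[ e_n^{\mathrm{cont}}(S)\le \delta_{2^{n-2}}(S). \]
   Context: An algorithm using $n$ adaptive continuous measurements is a map $A_n\colon F\to Y$ of the form $A_n(f)=\Phi(y_1,\dots,y_n)$, where $y_1=\lambda_1(f)$ for a continuous $\lambda_1\colon F\to\mathbb{R}$ and, for $k\ge2$, $y_k=\lambda_k^{(y_1,\dots,y_{k-1})}(f)$ with continuous functionals $\lambda_k^{(y_1,\dots,y_{k-1})}\colon F\to\mathbb{R}$ whose choice may depend arbitrarily on the previously computed values $y_1,\dots,y_{k-1}$; the reconstruction map $\Phi\colon\mathbb{R}^n\to Y$ is arbitrary. Define $e_n^{\mathrm{cont}}(S):=\inf_{A_n}\sup_{f\in F} d_Y(S(f),A_n(f))$, the infimum over all such algorithms. The manifold widths are $\delta_n(S):=\inf\{\sup_{f\in F} d_Y(S(f),\Phi(N(f))) : N\colon F\to\mathbb{R}^n \text{ continuous},\ \Phi\colon\mathbb{R}^n\to Y\text{ continuous}\}$. *)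

theory Defs
  imports "HOL-Analysis.Analysis"
begin

text \<open>R^m is encoded as the subspace of \<open>nat \<Rightarrow> real\<close> (product topology) of
  functions vanishing from index m on; on it the product topology is the Euclidean one.\<close>
definition Rn :: "nat \<Rightarrow> (nat \<Rightarrow> real) set" where
  "Rn m = {x. \<forall>i\<ge>m. x i = 0}"

fun adaptive_info :: "(nat \<Rightarrow> real list \<Rightarrow> 'f \<Rightarrow> real) \<Rightarrow> nat \<Rightarrow> 'f \<Rightarrow> real list" where
  "adaptive_info L 0 f = []"
| "adaptive_info L (Suc k) f =
     (let ys = adaptive_info L k f in ys @ [L k ys f])"

definition e_cont :: "('f::topological_space \<Rightarrow> 'y::metric_space) \<Rightarrow> nat \<Rightarrow> ereal" where
  "e_cont S n =
     (INF LP \<in> {L. \<forall>k ys. continuous_on UNIV (L k ys)} \<times> (UNIV :: (real list \<Rightarrow> 'y) set).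
        SUP f. ereal (dist (S f) ((snd LP) (adaptive_info (fst LP) n f))))"

definition manifold_width :: "('f::topological_space \<Rightarrow> 'y::metric_space) \<Rightarrow> nat \<Rightarrow> ereal" where
  "manifold_width S m =
     (INF NP \<in> {(N, \<Phi>). continuous_on UNIV N \<and> range N \<subseteq> Rn m
                        \<and> continuous_on (Rn m) (\<Phi> :: (nat \<Rightarrow> real) \<Rightarrow> 'y)}.
        SUP f. ereal (dist (S f) ((snd NP) ((fst NP) f))))"

end

theory Submission
  imports Defs
begin

text \<open>Fix an encoder N into R^m with m = 2^(n-2), a continuous decoder and a tolerance. The first
  measurement is the maximum norm r of N f. On the cube of radius r the decoder is uniformly
  continuous, so it suffices to find N f up to a grid step d, chosen such that r is a multiple of d.
  Then at least one coordinate lies exactly on the grid, and therefore m colours, rather than the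
  usual m + 1, suffice: with t_i = sin^2(pi x_i / d), colour k collects the points at which exactly
  the k coordinates with smallest t_i count as close to the grid. A partition of unity for
  the colours allows one to find, by n - 2 bisecting measurements, a colour whose weight is positive and
  known exactly. The last measurement is this weight times an injective bounded code of the cell.\<close>

section \<open>Adaptive schemes as a relation on inputs, and how to chain them\<close>

text \<open>Reconstruction is arbitrary, so only pairs with equal records matter and no decoder
  appears. The functionals are continuous on the whole space even if \<open>A\<close> is just a
  fibre, so that they can serve inside a larger scheme.\<close>

definition separates ::
  "nat \<Rightarrow> 'f::topological_space set \<Rightarrow> ('f \<Rightarrow> 'f \<Rightarrow> bool) \<Rightarrow> bool" where
  "separates n A R \<longleftrightarrow>
     (\<exists>L. (\<forall>k ys. continuous_on UNIV (L k ys)) \<and>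
          (\<forall>f\<in>A. \<forall>g\<in>A. adaptive_info L n f = adaptive_info L n g \<longrightarrow> R f g))"

lemma separates_0:
  assumes "\<And>f g. f \<in> A \<Longrightarrow> g \<in> A \<Longrightarrow> R f g"
  shows "separates 0 A R"
  unfolding separates_def using assms
  by (intro exI[of _ "\<lambda>_ _ _. 0"]) auto

lemma separates_mono:
  assumes "separates n B Q" "A \<subseteq> B" "\<And>f g. f \<in> A \<Longrightarrow> g \<in> A \<Longrightarrow> Q f g \<Longrightarrow> R f g"
  shows "separates n A R"
  using assms unfolding separates_def by (meson subsetD)

text \<open>This is where adaptivity enters: each value \<open>y\<close> of the first measurement
  gets its own scheme, chosen without any continuity in \<open>y\<close>.\<close>

lemma separates_Suc:
  fixes \<phi> :: "'f::topological_space \<Rightarrow> real"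
  assumes cont: "continuous_on UNIV \<phi>"
    and fibre: "\<And>y. separates n {f \<in> A. \<phi> f = y} R"
  shows "separates (Suc n) A R"
proof -
  have "\<exists>M. \<forall>y. (\<forall>k ys. continuous_on UNIV (M y k ys)) \<and>
      (\<forall>f\<in>{f \<in> A. \<phi> f = y}. \<forall>g\<in>{f \<in> A. \<phi> f = y}.
         adaptive_info (M y) n f = adaptive_info (M y) n g \<longrightarrow> R f g)"
    using fibre unfolding separates_def by (intro choice allI)
  then obtain M where M: "\<forall>y. (\<forall>k ys. continuous_on UNIV (M y k ys)) \<and>
      (\<forall>f\<in>{f \<in> A. \<phi> f = y}. \<forall>g\<in>{f \<in> A. \<phi> f = y}.
         adaptive_info (M y) n f = adaptive_info (M y) n g \<longrightarrow> R f g)" ..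
  \<comment> \<open>The head of the record is the value of \<open>\<phi>\<close> and selects the
    scheme, which then sees its own index and record, shifted by one.\<close>
  define L where "L k ys = (if k = 0 then \<phi> else M (hd ys) (k - 1) (tl ys))" for k ys
  have info: "adaptive_info L (Suc k) f = \<phi> f # adaptive_info (M (\<phi> f)) k f" for k f
  proof (induction k)
    case 0
    show ?case by (simp add: L_def)
  next
    case (Suc k)
    have "adaptive_info L (Suc (Suc k)) f =
        adaptive_info L (Suc k) f @ [L (Suc k) (adaptive_info L (Suc k) f) f]"
      by (simp only: adaptive_info.simps(2) Let_def)
    also have "\<dots> = \<phi> f # adaptive_info (M (\<phi> f)) k f @ [M (\<phi> f) k (adaptive_info (M (\<phi> f)) k f) f]"
      unfolding Suc.IH by (simp add: L_def)
    also have "\<dots> = \<phi> f # adaptive_info (M (\<phi> f)) (Suc k) f"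
      by (simp add: Let_def)
    finally show ?case .
  qed
  have "continuous_on UNIV (L k ys)" for k ys
    using cont M by (simp add: L_def)
  then show ?thesis
    unfolding separates_def
  proof (intro exI[of _ L] conjI allI ballI impI)
    fix f g assume "f \<in> A" "g \<in> A" "adaptive_info L (Suc n) f = adaptive_info L (Suc n) g"
    then show "R f g"
      unfolding info using M[THEN spec, of "\<phi> f"] by auto
  qed
qed

text \<open>Bisection: of two halves of the index set with positive total, one has a positive subtotal,
  and measuring the first subtotal makes both known exactly.\<close>
lemma separates_bisect:
  fixes p :: "'i \<Rightarrow> 'f::topological_space \<Rightarrow> real"
  assumes "finite C" "card C \<le> 2 ^ b"
    and "\<And>k. k \<in> C \<Longrightarrow> continuous_on UNIV (p k)"
    and "c > 0" "\<And>f. f \<in> A \<Longrightarrow> (\<Sum>k\<in>C. p k f) = c"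
    and "\<And>k v. k \<in> C \<Longrightarrow> v > 0 \<Longrightarrow> separates q {f \<in> A. p k f = v} R"
  shows "separates (b + q) A R"
  using assms
proof (induction b arbitrary: C c A)
  case 0
  show ?case
  proof (cases "C = {}")
    case True
    then have "A \<subseteq> {}"
      using 0 by auto
    then show ?thesis
      by (auto simp: separates_def intro: exI[of _ "\<lambda>_ _ _. 0"])
  next
    case False
    with 0 obtain k where k: "C = {k}"
      by (metis card_1_singletonE card_gt_0_iff le_antisym power_0 Suc_leI One_nat_def)
    with 0 have "separates q {f \<in> A. p k f = c} R"
      by simp
    moreover have "{f \<in> A. p k f = c} = A"
      using 0 k by auto
    ultimately show ?thesis
      by simp
  qed
next
  case (Suc b)
  \<comment> \<open>The minimum covers the case where \<open>C\<close> has fewer than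
    \<open>2 ^ b\<close> elements; then \<open>D\<close> is all of \<open>C\<close>.\<close>
  obtain D where D: "D \<subseteq> C" "card D = min (card C) (2 ^ b)"
    using obtain_subset_with_card_n[of "min (card C) (2 ^ b)" C] by (metis min.cobounded1)
  have fin: "finite D" "finite (C - D)"
    using finite_subset[OF D(1) Suc.prems(1)] Suc.prems(1) by auto
  have cD: "card D \<le> 2 ^ b" "card (C - D) \<le> 2 ^ b"
    using D Suc.prems(1,2) fin by (auto simp: card_Diff_subset)
  have "separates (Suc (b + q)) A R"
  proof (rule separates_Suc)
    show "continuous_on UNIV (\<lambda>f. \<Sum>k\<in>D. p k f)"
      using D Suc.prems(3) by (intro continuous_on_sum) auto
    fix y
    have q: "separates q {f \<in> {f \<in> A. (\<Sum>k\<in>D. p k f) = y}. p k f = v} R" if "k \<in> C" "v > 0" for k v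
      by (rule separates_mono[OF Suc.prems(6)[OF that]]) auto
    show "separates (b + q) {f \<in> A. (\<Sum>k\<in>D. p k f) = y} R"
    proof (cases "y > 0")
      case True
      show ?thesis
        by (rule Suc.IH[OF fin(1) cD(1) _ True]) (use D q Suc.prems(3) in auto)
    next
      case False
      \<comment> \<open>As \<open>y\<close> is at most 0, the other half has total
        \<open>c - y\<close>, which is at least \<open>c\<close> and hence positive.\<close>
      have "(\<Sum>k\<in>C - D. p k f) = c - y" if "f \<in> {f \<in> A. (\<Sum>k\<in>D. p k f) = y}" for f
        using that Suc.prems(1,5) D by (auto simp: sum_diff)
      then show ?thesis
        using False Suc.prems(4)
        by (intro Suc.IH[OF fin(2) cD(2), where c = "c - y"]) (use q Suc.prems(3) in auto)
    qed
  qed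
  then show ?case
    by simp
qed

section \<open>Continuity, compactness and the choice of the grid step\<close>

text \<open>The factor \<open>c\<close> can jump only where \<open>g\<close> vanishes, and there its
  boundedness forces the product to 0. This lets a discrete code be measured continuously.\<close>

lemma continuous_on_mult_locally_constant:
  fixes g c :: "'f::topological_space \<Rightarrow> real"
  assumes g: "continuous_on UNIV g"
    and bound: "\<And>x. \<bar>c x\<bar> \<le> 1"
    and const: "\<And>x. g x \<noteq> 0 \<Longrightarrow> \<forall>\<^sub>F y in at x. c y = c x"
  shows "continuous_on UNIV (\<lambda>x. g x * c x)"
  unfolding continuous_on_def
proof
  fix x
  have lim: "(g \<longlongrightarrow> g x) (at x)"
    using g by (simp add: continuous_on_def)
  show "((\<lambda>x. g x * c x) \<longlongrightarrow> g x * c x) (at x)"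
  proof (cases "g x = 0")
    case True
    have "((\<lambda>y. g y * c y) \<longlongrightarrow> 0) (at x)"
    proof (rule Lim_null_comparison)
      show "\<forall>\<^sub>F y in at x. norm (g y * c y) \<le> \<bar>g y\<bar>"
        using bound by (simp add: abs_mult mult_left_le)
      show "((\<lambda>y. \<bar>g y\<bar>) \<longlongrightarrow> 0) (at x)"
        using lim True by (simp add: tendsto_rabs_zero)
    qed
    then show ?thesis
      using True by simp
  next
    case False
    have "((\<lambda>y. g y * c x) \<longlongrightarrow> g x * c x) (at x)"
      by (intro tendsto_intros lim)
    then show ?thesis
      by (rule Lim_transform_eventually) (use const[OF False] in \<open>auto elim: eventually_mono\<close>)
  qed
qed

lemma continuous_on_Max_image:
  fixes h :: "'i \<Rightarrow> 'f::topological_space \<Rightarrow> real"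
  assumes "finite I" "I \<noteq> {}" "\<And>i. i \<in> I \<Longrightarrow> continuous_on UNIV (h i)"
  shows "continuous_on UNIV (\<lambda>f. Max ((\<lambda>i. h i f) ` I))"
  using assms
proof (induction rule: finite_ne_induct)
  case (insert i I)
  then have "continuous_on UNIV (\<lambda>f. max (h i f) (Max ((\<lambda>i. h i f) ` I)))"
    by (intro continuous_on_max) auto
  with insert show ?case by simp
qed simp

text \<open>Tychonoff: the cube is a product of intervals, followed by singletons from index
  \<open>m\<close> on.\<close>

lemma compact_Rn_cube: "compact {x \<in> Rn m. \<forall>i<m. \<bar>x i\<bar> \<le> r}"
proof -
  have "compactin (product_topology (\<lambda>i::nat. euclideanreal) UNIV)
      (PiE UNIV (\<lambda>i. if i < m then {-r..r} else {0}))"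
    by (subst compactin_PiE) auto
  moreover have "x \<in> PiE UNIV (\<lambda>i. if i < m then {-r..r} else {0}) \<longleftrightarrow>
      (\<forall>i\<ge>m. x i = 0) \<and> (\<forall>i<m. \<bar>x i\<bar> \<le> r)" for x
    unfolding PiE_UNIV_domain Pi_iff abs_le_iff by (auto simp: not_less minus_le_iff split: if_splits)
  then have "PiE UNIV (\<lambda>i. if i < m then {-r..r} else {0}) = {x \<in> Rn m. \<forall>i<m. \<bar>x i\<bar> \<le> r}"
    unfolding Rn_def by blast
  ultimately show ?thesis
    by (simp add: euclidean_product_topology)
qed

text \<open>Heine-Cantor on the compact cube, with the metric of the function space translated into
  coordinatewise bounds.\<close>

lemma uniform_on_Rn_cube:
  fixes \<Phi> :: "(nat \<Rightarrow> real) \<Rightarrow> 'y::metric_space"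
  assumes "continuous_on (Rn m) \<Phi>" "\<epsilon> > 0"
  obtains \<delta> where "\<delta> > 0"
    "\<And>x y. x \<in> Rn m \<Longrightarrow> y \<in> Rn m \<Longrightarrow> (\<And>i. i < m \<Longrightarrow> \<bar>x i\<bar> \<le> r) \<Longrightarrow> (\<And>i. i < m \<Longrightarrow> \<bar>y i\<bar> \<le> r) \<Longrightarrow>
       (\<And>i. i < m \<Longrightarrow> \<bar>x i - y i\<bar> < \<delta>) \<Longrightarrow> dist (\<Phi> x) (\<Phi> y) < \<epsilon>"
proof -
  let ?K = "{x \<in> Rn m. \<forall>i<m. \<bar>x i\<bar> \<le> r}"
  have "continuous_on ?K \<Phi>"
    by (rule continuous_on_subset[OF assms(1)]) auto
  then have "uniformly_continuous_on ?K \<Phi>"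
    by (rule compact_uniformly_continuous[OF _ compact_Rn_cube])
  then obtain e where e: "e > 0"
    "\<And>y x. y \<in> ?K \<Longrightarrow> x \<in> ?K \<Longrightarrow> dist x y < e \<Longrightarrow> dist (\<Phi> x) (\<Phi> y) < \<epsilon>"
    using assms(2) by (rule uniformly_continuous_onE) (rule that)
  show ?thesis
  \<comment> \<open>The weights of the metric sum to 2, so the distance is at most
    \<open>2 * (e / 3)\<close>, which is less than \<open>e\<close>.\<close>
  proof (rule that[of "e / 3"])
    fix x y
    assume xy: "x \<in> Rn m" "y \<in> Rn m" "\<And>i. i < m \<Longrightarrow> \<bar>x i\<bar> \<le> r" "\<And>i. i < m \<Longrightarrow> \<bar>y i\<bar> \<le> r"
      and close: "\<And>i. i < m \<Longrightarrow> \<bar>x i - y i\<bar> < e / 3"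
    have le: "dist (x i) (y i) \<le> e / 3" for i
      using close[of i] xy(1,2) e(1) by (cases "i < m") (auto simp: dist_real_def Rn_def)
    have geo: "summable (\<lambda>n. (1 / 2) ^ n * (e / 3))" "(\<Sum>n. (1 / 2) ^ n * (e / 3)) = 2 * (e / 3)"
      using sums_mult2[OF geometric_sums[of "1/2 :: real"], of "e / 3"]
      by (auto simp: sums_iff)
    have "dist x y = (\<Sum>n. (1 / 2) ^ n * min (dist (x (from_nat n)) (y (from_nat n))) 1)"
      by (rule dist_fun_def)
    also have "\<dots> \<le> (\<Sum>n. (1 / 2) ^ n * (e / 3))"
    proof (rule suminf_le)
      show "(1 / 2) ^ n * min (dist (x (from_nat n)) (y (from_nat n))) 1 \<le> (1 / 2) ^ n * (e / 3)" for n
        using le[of "from_nat n"] by (intro mult_left_mono) auto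
      show "summable (\<lambda>n. (1 / 2) ^ n * min (dist (x (from_nat n)) (y (from_nat n))) 1)"
        by (rule summable_comparison_test'[of "\<lambda>n. (1 / 2) ^ n"]) (auto simp: summable_geometric)
    qed (rule geo)
    also have "\<dots> < e"
      using geo e(1) by simp
    finally show "dist (\<Phi> x) (\<Phi> y) < \<epsilon>"
      using xy by (intro e(2)) auto
  qed (use e in simp)
qed

text \<open>Puts the measured norm on the grid: the step is \<open>r / K\<close> for an integer
  \<open>K\<close> above \<open>r / \<delta>\<close>, or \<open>\<delta>\<close> itself if
  \<open>r = 0\<close>.\<close>

lemma grid_step_dividing:
  fixes r \<delta> :: real
  assumes "r \<ge> 0" "\<delta> > 0"
  obtains d :: real and K :: int where "d > 0" "d \<le> \<delta>" "r = of_int K * d"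
proof (cases "r = 0")
  case True
  then show ?thesis
    using that[of \<delta> 0] assms by simp
next
  case False
  obtain K :: nat where K: "r / \<delta> < real K"
    using reals_Archimedean2 by blast
  with False assms have "real K > 0"
    by (smt (verit) divide_nonneg_pos)
  with K False assms show ?thesis
    by (intro that[of "r / real K" "int K"]) (auto simp: field_simps)
qed

section \<open>Weights for splitting coordinates into those near the grid and the rest\<close>

text \<open>Positive iff every coordinate in I is smaller than every coordinate outside I, no coordinate
  in I is 1 and no coordinate outside I is 0.\<close>
definition gap_weight :: "nat \<Rightarrow> nat set \<Rightarrow> (nat \<Rightarrow> real) \<Rightarrow> real" where
  "gap_weight m I t =
     (\<Prod>i\<in>I. \<Prod>j\<in>{..<m} - I. max 0 (t j - t i)) * (\<Prod>i\<in>I. 1 - t i) * (\<Prod>j\<in>{..<m} - I. t j)"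

lemma gap_weight_nonneg:
  assumes "I \<subseteq> {..<m}" "\<And>i. 0 \<le> t i" "\<And>i. t i \<le> 1"
  shows "gap_weight m I t \<ge> 0"
  unfolding gap_weight_def using assms
  by (intro mult_nonneg_nonneg prod_nonneg) auto

lemma gap_weight_nonzeroD:
  assumes "I \<subseteq> {..<m}" "gap_weight m I t \<noteq> 0"
  shows "\<And>i j. i \<in> I \<Longrightarrow> j < m \<Longrightarrow> j \<notin> I \<Longrightarrow> t i < t j"
    and "\<And>i. i \<in> I \<Longrightarrow> t i \<noteq> 1"
    and "\<And>j. j < m \<Longrightarrow> j \<notin> I \<Longrightarrow> t j \<noteq> 0"
proof -
  have fin: "finite I"
    using assms(1) finite_subset by blast
  show "t i < t j" if "i \<in> I" "j < m" "j \<notin> I" for i j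
  proof (rule ccontr)
    assume "\<not> ?thesis"
    then have "max 0 (t j - t i) = 0"
      by simp
    then have "(\<Prod>j\<in>{..<m} - I. max 0 (t j - t i)) = 0"
      using that by (intro prod_zero) auto
    then have "(\<Prod>i\<in>I. \<Prod>j\<in>{..<m} - I. max 0 (t j - t i)) = 0"
      using that fin by (intro prod_zero) auto
    with assms(2) show False
      by (simp add: gap_weight_def)
  qed
  show "t i \<noteq> 1" if "i \<in> I" for i
    using assms(2) that fin unfolding gap_weight_def by (auto simp: prod_zero_iff)
  show "t j \<noteq> 0" if "j < m" "j \<notin> I" for j
    using assms(2) that unfolding gap_weight_def by (auto simp: prod_zero_iff)
qed

text \<open>Two different sets of equal size each have an element outside the other, and
  \<open>t\<close> at each of these would be smaller than at the other. Hence the sets of one colour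
  have disjoint supports.\<close>

lemma gap_weight_unique:
  assumes "I \<subseteq> {..<m}" "J \<subseteq> {..<m}" "card I = card J"
    and "gap_weight m I t \<noteq> 0" "gap_weight m J t \<noteq> 0"
  shows "I = J"
proof (rule ccontr)
  assume "I \<noteq> J"
  have "finite I" "finite J"
    using assms(1,2) finite_subset by blast+
  with \<open>I \<noteq> J\<close> assms(3) obtain i j where ij: "i \<in> I" "i \<notin> J" "j \<in> J" "j \<notin> I"
    by (metis card_subset_eq subsetI)
  with assms(1,2) have "i < m" "j < m"
    by auto
  with ij have "t i < t j" "t j < t i"
    using gap_weight_nonzeroD(1)[OF assms(1,4)] gap_weight_nonzeroD(1)[OF assms(2,5)] by auto
  then show False
    by simp
qed

lemma gap_weight_sum_pos:
  assumes "\<And>i. 0 \<le> t i" "\<And>i. t i \<le> 1"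
  shows "(\<Sum>I\<in>Pow {..<m}. gap_weight m I t) > 0"
proof (rule sum_pos2)
  \<comment> \<open>The zero set of \<open>t\<close> always has positive weight: inside it
    \<open>t\<close> is 0, outside it \<open>t\<close> is positive, so all factors are
    positive.\<close>
  let ?I = "{i. i < m \<and> t i = 0}"
  show "?I \<in> Pow {..<m}"
    by auto
  have "t j > 0" if "j \<in> {..<m} - ?I" for j
    using that assms(1)[of j] by auto
  then show "gap_weight m ?I t > 0"
    unfolding gap_weight_def
    by (intro mult_pos_pos prod_pos) (auto simp: less_max_iff_disj)
qed (use gap_weight_nonneg[of _ m t] assms in auto)

text \<open>For the empty set only the product of all \<open>t j\<close> remains, so one coordinate
  on the grid makes this colour disappear.\<close>

lemma gap_weight_empty:
  assumes "i < m" "t i = 0"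
  shows "gap_weight m {} t = 0"
  using assms by (auto simp: gap_weight_def intro!: prod_zero)

lemma continuous_on_gap_weight:
  fixes t :: "'f::topological_space \<Rightarrow> nat \<Rightarrow> real"
  assumes "\<And>i. continuous_on UNIV (\<lambda>f. t f i)"
  shows "continuous_on UNIV (\<lambda>f. gap_weight m I (t f))"
  unfolding gap_weight_def
  by (intro continuous_intros continuous_on_max continuous_on_prod assms)


section \<open>Locating a point that has a coordinate on the grid\<close>

lemma sum_eq_single:
  fixes g :: "'i \<Rightarrow> real"
  assumes "finite A" "I \<in> A" "\<And>J. J \<in> A \<Longrightarrow> g J \<noteq> 0 \<Longrightarrow> J = I"
  shows "(\<Sum>J\<in>A. g J * c J) = g I * c I"
  using assms by (subst sum.remove[of _ I]) (auto intro!: sum.neutral)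

text \<open>The excluded values 0 and 1 are taken exactly where the floor of \<open>x\<close>,
  respectively of \<open>x + 1 / 2\<close>, can jump.\<close>

lemma nonint_of_sin_square:
  fixes x :: real
  shows "(sin (pi * x))\<^sup>2 \<noteq> 0 \<Longrightarrow> x \<notin> \<int>"
    and "(sin (pi * x))\<^sup>2 \<noteq> 1 \<Longrightarrow> x + 1 / 2 \<notin> \<int>"
proof -
  show "(sin (pi * x))\<^sup>2 \<noteq> 0 \<Longrightarrow> x \<notin> \<int>"
    by (auto elim!: Ints_cases)
  assume ne: "(sin (pi * x))\<^sup>2 \<noteq> 1"
  show "x + 1 / 2 \<notin> \<int>"
  proof
    assume "x + 1 / 2 \<in> \<int>"
    then obtain z :: int where "x + 1 / 2 = of_int z"
      by (auto elim: Ints_cases)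
    then have x: "x = of_int z - 1 / 2"
      by linarith
    have "cos (pi * x) = 0"
      by (simp add: x right_diff_distrib cos_diff)
    then have "(sin (pi * x))\<^sup>2 = 1"
      using sin_cos_squared_add[of "pi * x"] by simp
    with ne show False ..
  qed
qed

text \<open>The grid assumption kills the weight of \<open>I = {}\<close>, so the colours \<open>k = card I\<close> range over
  \<open>1, \<dots>, m\<close> only. Each colour class splits into disjoint open cells, on which the label is
  constant. Labels omit I, which costs only a factor 2 in the diameter.\<close>
lemma separates_near_grid:
  fixes x :: "'f::topological_space \<Rightarrow> nat \<Rightarrow> real"
  assumes cont: "\<And>i. continuous_on UNIV (\<lambda>f. x f i)"
    and d: "d > 0"
    and grid: "\<And>f. f \<in> A \<Longrightarrow> \<exists>i<m. \<exists>K::int. x f i = of_int K * d"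
    and m: "m \<le> 2 ^ b"
  shows "separates (b + 1) A (\<lambda>f g. \<forall>i<m. \<bar>x f i - x g i\<bar> < 2 * d)"
proof -
  define t where "t f i = (sin (pi * (x f i / d)))\<^sup>2" for f i
  define w where "w I f = gap_weight m I (t f)" for I f
  define W where "W f = (\<Sum>I\<in>Pow {..<m}. w I f)" for f
  define q where "q I f = w I f / W f" for I f
  define Col where "Col k = {I. I \<subseteq> {..<m} \<and> card I = k}" for k
  define p where "p k f = (\<Sum>I\<in>Col k. q I f)" for k f
  \<comment> \<open>Coordinates in \<open>I\<close> are rounded to the nearest grid point, with
    jumps at midpoints (\<open>t = 1\<close>); the others are rounded down, with jumps on the grid
    (\<open>t = 0\<close>). The weight of \<open>I\<close> vanishes at both kinds of jump.\<close>
  define label where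
    "label I f = map (\<lambda>i. \<lfloor>x f i / d + (if i \<in> I then 1 / 2 else 0)\<rfloor>) [0..<m]" for I f
  \<comment> \<open>Injective in the label, with values in (0, 1], as the continuity of
    \<open>q I f * code I f\<close> requires boundedness.\<close>
  define code where "code I f = 1 / (1 + real (to_nat (label I f)))" for I f

  have t01: "0 \<le> t f i" "t f i \<le> 1" for f i
    by (auto simp: t_def abs_square_le_1)
  have contx: "continuous_on UNIV (\<lambda>f. x f i / d)" for i
    using cont d by (intro continuous_intros) auto
  have contt: "continuous_on UNIV (\<lambda>f. t f i)" for i
    unfolding t_def
    by (intro continuous_on_power continuous_on_mult_left contx
        continuous_on_compose2[OF continuous_on_sin[OF continuous_on_id, of UNIV]]) auto
  have contw: "continuous_on UNIV (w I)" for I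
    unfolding w_def by (intro continuous_on_gap_weight contt)
  have Wpos: "W f > 0" for f
    unfolding W_def w_def by (intro gap_weight_sum_pos t01)
  have contq: "continuous_on UNIV (q I)" for I
  proof -
    have "W f \<noteq> 0" for f
      using Wpos[of f] by simp
    moreover have "continuous_on UNIV W"
      unfolding W_def by (intro continuous_on_sum contw)
    ultimately show ?thesis
      unfolding q_def by (intro continuous_on_divide contw) auto
  qed
  have finCol: "finite (Col k)" for k
    by (rule finite_subset[of _ "Pow {..<m}"]) (auto simp: Col_def)
  have w_nz: "w I f \<noteq> 0" if "q I f \<noteq> 0" for I f
    using that by (auto simp: q_def)

  have contqc: "continuous_on UNIV (\<lambda>f. q I f * code I f)" if I: "I \<subseteq> {..<m}" for I
  proof (rule continuous_on_mult_locally_constant[OF contq])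
    show "\<bar>code I f\<bar> \<le> 1" for f
      by (simp add: code_def)
    fix f assume "q I f \<noteq> 0"
    then have nz: "gap_weight m I (t f) \<noteq> 0"
      using w_nz by (simp add: w_def)
    have "\<forall>\<^sub>F g in at f. \<lfloor>x g i / d + (if i \<in> I then 1 / 2 else 0)\<rfloor> =
        \<lfloor>x f i / d + (if i \<in> I then 1 / 2 else 0)\<rfloor>" if "i < m" for i
    proof (rule eventually_floor_eq)
      have "((\<lambda>g. x g i / d) \<longlongrightarrow> x f i / d) (at f)"
        using contx by (simp add: continuous_on_def)
      then show "((\<lambda>g. x g i / d + (if i \<in> I then 1 / 2 else 0)) \<longlongrightarrow>
          x f i / d + (if i \<in> I then 1 / 2 else 0)) (at f)"
        by (rule tendsto_add[OF _ tendsto_const])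
      show "x f i / d + (if i \<in> I then 1 / 2 else 0) \<notin> \<int>"
        using gap_weight_nonzeroD(2,3)[OF I nz, of i] that nonint_of_sin_square[of "x f i / d"]
        by (auto simp: t_def)
    qed
    then have "\<forall>\<^sub>F g in at f. \<forall>i\<in>{..<m}. \<lfloor>x g i / d + (if i \<in> I then 1 / 2 else 0)\<rfloor> =
        \<lfloor>x f i / d + (if i \<in> I then 1 / 2 else 0)\<rfloor>"
      by (intro eventually_ball_finite) auto
    then show "\<forall>\<^sub>F g in at f. code I g = code I f"
      by eventually_elim (auto simp: code_def label_def intro!: arg_cong[where f = to_nat])
  qed

  have sum1: "(\<Sum>k\<in>{1..m}. p k f) = 1" if f: "f \<in> A" for f
  proof -
    obtain i and K :: int where i: "i < m" "x f i = of_int K * d"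
      using grid[OF f] by blast
    then have "t f i = 0"
      using d by (simp add: t_def)
    then have q0: "q {} f = 0"
      using gap_weight_empty[OF i(1)] by (simp add: q_def w_def)
    have "(\<Sum>k\<in>{1..m}. p k f) = (\<Sum>I\<in>(\<Union>k\<in>{1..m}. Col k). q I f)"
      unfolding p_def by (intro sum.UNION_disjoint[symmetric] ballI impI finCol) (auto simp: Col_def)
    also have "\<dots> = (\<Sum>I\<in>Pow {..<m}. q I f)"
    proof (rule sum.mono_neutral_left)
      show "\<forall>I\<in>Pow {..<m} - (\<Union>k\<in>{1..m}. Col k). q I f = 0"
      proof
        fix I assume I: "I \<in> Pow {..<m} - (\<Union>k\<in>{1..m}. Col k)"
        then have "finite I" "card I \<le> m"
          using finite_subset[of I "{..<m}"] card_mono[of "{..<m}" I] by auto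
        with I have "I = {}"
          by (cases "card I = 0") (auto simp: Col_def)
        with q0 show "q I f = 0"
          by simp
      qed
    qed (auto simp: Col_def)
    also have "\<dots> = 1"
      using Wpos[of f] by (simp add: q_def W_def flip: sum_divide_distrib)
    finally show ?thesis .
  qed

  show ?thesis
  proof (rule separates_bisect[where C = "{1..m}" and p = p and c = 1])
    show "continuous_on UNIV (p k)" for k
      unfolding p_def by (intro continuous_on_sum contq)
    fix k and v :: real
    assume "v > 0"
    have "separates (Suc 0) {f \<in> A. p k f = v} (\<lambda>f g. \<forall>i<m. \<bar>x f i - x g i\<bar> < 2 * d)"
    proof (rule separates_Suc)
      show "continuous_on UNIV (\<lambda>f. \<Sum>I\<in>Col k. q I f * code I f)"
        by (intro continuous_on_sum contqc) (auto simp: Col_def)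
      fix y
      \<comment> \<open>As \<open>v\<close> is positive, exactly one set of colour \<open>k\<close>
        has nonzero weight, and that weight is \<open>v\<close>. The last measurement is thus
        \<open>v\<close> times a single code, and \<open>v\<close> is known.\<close>
      have cell: "\<exists>I. v * code I f = y" if "p k f = v" "(\<Sum>I\<in>Col k. q I f * code I f) = y" for f
      proof -
        have "(\<Sum>I\<in>Col k. q I f) \<noteq> 0"
          using that(1) \<open>v > 0\<close> by (simp add: p_def)
        then obtain I where I: "I \<in> Col k" "q I f \<noteq> 0"
          by (rule sum.not_neutral_contains_not_neutral)
        have unique: "J = I" if "J \<in> Col k" "q J f \<noteq> 0" for J
          using that I w_nz[of J f] w_nz[of I f]
          by (intro gap_weight_unique[of J m I "t f"]) (auto simp: Col_def w_def)
        have "p k f = q I f"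
          using sum_eq_single[OF finCol I(1), of "\<lambda>I. q I f" "\<lambda>_. 1"] unique by (simp add: p_def)
        moreover have "(\<Sum>I\<in>Col k. q I f * code I f) = q I f * code I f"
          by (rule sum_eq_single[OF finCol I(1) unique])
        ultimately show ?thesis
          using that by auto
      qed
      show "separates 0 {f \<in> {f \<in> A. p k f = v}. (\<Sum>I\<in>Col k. q I f * code I f) = y}
          (\<lambda>f g. \<forall>i<m. \<bar>x f i - x g i\<bar> < 2 * d)"
      proof (intro separates_0 allI impI)
        fix f g i
        assume "f \<in> {f \<in> {f \<in> A. p k f = v}. (\<Sum>I\<in>Col k. q I f * code I f) = y}"
          and "g \<in> {f \<in> {f \<in> A. p k f = v}. (\<Sum>I\<in>Col k. q I f * code I f) = y}"
          and i: "i < m"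
        then obtain I J where "v * code I f = y" "v * code J g = y"
          using cell by blast
        then have "code I f = code J g"
          using \<open>v > 0\<close> by auto
        then have "label I f = label J g"
          by (simp add: code_def)
        then have "\<lfloor>x f i / d + (if i \<in> I then 1 / 2 else 0)\<rfloor> =
            \<lfloor>x g i / d + (if i \<in> J then 1 / 2 else 0)\<rfloor>"
          using i by (simp add: label_def)
        \<comment> \<open>\<open>I\<close> and \<open>J\<close> may differ: equal floors give a
          difference below 1, and the shifts add at most 1/2.\<close>
        then have "\<bar>x f i / d - x g i / d\<bar> < 2"
          by (auto split: if_splits) linarith+
        then have "\<bar>x f i - x g i\<bar> / d < 2"
          using d by (simp flip: diff_divide_distrib)
        then show "\<bar>x f i - x g i\<bar> < 2 * d"
          using d by (simp add: field_simps)
      qed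
    qed
    then show "separates 1 {f \<in> A. p k f = v} (\<lambda>f g. \<forall>i<m. \<bar>x f i - x g i\<bar> < 2 * d)"
      by simp
  qed (use sum1 m in auto)
qed

section \<open>From continuous encoders and decoders to adaptive algorithms\<close>

text \<open>The count is one measurement for the norm, \<open>b\<close> for bisection and one for
  the code. By adaptivity the grid step may depend on the norm, so uniform continuity on each cube
  suffices and \<open>N\<close> may be unbounded.\<close>

lemma separates_manifold:
  fixes N :: "'f::topological_space \<Rightarrow> nat \<Rightarrow> real" and \<Phi> :: "(nat \<Rightarrow> real) \<Rightarrow> 'y::metric_space"
  assumes N: "continuous_on UNIV N" "range N \<subseteq> Rn m"
    and \<Phi>: "continuous_on (Rn m) \<Phi>"
    and m: "0 < m" "m \<le> 2 ^ b" and \<epsilon>: "\<epsilon> > 0"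
  shows "separates (Suc (b + 1)) UNIV (\<lambda>f g. dist (\<Phi> (N f)) (\<Phi> (N g)) < \<epsilon>)"
proof (rule separates_Suc)
  have contN: "continuous_on UNIV (\<lambda>f. N f i)" for i
    using continuous_on_product_then_coordinatewise[OF N(1)] .
  define r where "r f = Max ((\<lambda>i. \<bar>N f i\<bar>) ` {..<m})" for f
  show "continuous_on UNIV r"
    unfolding r_def using m contN by (intro continuous_on_Max_image continuous_on_rabs) auto
  fix y
  show "separates (b + 1) {f \<in> UNIV. r f = y} (\<lambda>f g. dist (\<Phi> (N f)) (\<Phi> (N g)) < \<epsilon>)"
  proof (cases "y \<ge> 0")
    case True
    obtain \<delta> where \<delta>: "\<delta> > 0"
      "\<And>x z. x \<in> Rn m \<Longrightarrow> z \<in> Rn m \<Longrightarrow> (\<And>i. i < m \<Longrightarrow> \<bar>x i\<bar> \<le> y) \<Longrightarrow> (\<And>i. i < m \<Longrightarrow> \<bar>z i\<bar> \<le> y) \<Longrightarrow>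
       (\<And>i. i < m \<Longrightarrow> \<bar>x i - z i\<bar> < \<delta>) \<Longrightarrow> dist (\<Phi> x) (\<Phi> z) < \<epsilon>"
      using uniform_on_Rn_cube[OF \<Phi> \<epsilon>, of y] by metis
    \<comment> \<open>Half of \<open>\<delta>\<close>, because points in the same cell are only
      known to agree up to \<open>2 * d\<close>.\<close>
    obtain d and K :: int where d: "d > 0" "d \<le> \<delta> / 2" "y = of_int K * d"
      using grid_step_dividing[OF True, of "\<delta> / 2"] \<delta>(1) by auto
    have "separates (b + 1) {f. r f = y} (\<lambda>f g. \<forall>i<m. \<bar>N f i - N g i\<bar> < 2 * d)"
    proof (rule separates_near_grid[OF contN d(1) _ m(2)])
      fix f assume "f \<in> {f. r f = y}"
      then have "y \<in> (\<lambda>i. \<bar>N f i\<bar>) ` {..<m}"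
        using m(1) Max_in[of "(\<lambda>i. \<bar>N f i\<bar>) ` {..<m}"] by (auto simp: r_def)
      then obtain i where i: "i < m" "y = \<bar>N f i\<bar>"
        by auto
      \<comment> \<open>The norm determines this coordinate only up to sign, but both signs give
        grid points.\<close>
      then have "N f i = of_int K * d \<or> N f i = of_int (- K) * d"
        using d(3) by auto
      with i show "\<exists>i<m. \<exists>K::int. N f i = of_int K * d"
        by blast
    qed
    then show ?thesis
    proof (rule separates_mono)
      fix f g
      assume "f \<in> {f \<in> UNIV. r f = y}" "g \<in> {f \<in> UNIV. r f = y}"
        and close: "\<forall>i<m. \<bar>N f i - N g i\<bar> < 2 * d"
      then have r: "r f = y" "r g = y"
        by auto
      show "dist (\<Phi> (N f)) (\<Phi> (N g)) < \<epsilon>"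
      proof (rule \<delta>(2))
        have "\<bar>N h i\<bar> \<le> r h" if "i < m" for h i
          using that by (simp add: r_def)
        from this[of _ f] this[of _ g] show "\<bar>N f i\<bar> \<le> y" "\<bar>N g i\<bar> \<le> y" if "i < m" for i
          using that r by auto
        show "\<bar>N f i - N g i\<bar> < \<delta>" if "i < m" for i
          using close that d(2) by force
      qed (use N(2) in auto)
    qed auto
  next
    case False
    have "0 \<le> r f" for f
      using m(1) by (auto simp: r_def intro!: Max_ge_iff[THEN iffD2])
    with False have "{f \<in> UNIV. r f = y} = {}"
      by auto
    then show ?thesis
      by (auto simp: separates_def intro: exI[of _ "\<lambda>_ _ _. 0"])
  qed
qed

text \<open>The decoder picks any input with the observed record and returns its value under
  \<open>G\<close>, which is within \<open>\<epsilon>\<close> of the true one; the triangle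
  inequality does the rest. On records that never occur its value is irrelevant.\<close>

lemma e_cont_le_of_separates:
  fixes S G :: "'f::topological_space \<Rightarrow> 'y::metric_space"
  assumes "separates n UNIV (\<lambda>f g. dist (G f) (G g) < \<epsilon>)"
  shows "e_cont S n \<le> (SUP f. ereal (dist (S f) (G f))) + ereal \<epsilon>"
proof -
  obtain L where L: "\<And>k ys. continuous_on UNIV (L k ys)"
    "\<And>f g. adaptive_info L n f = adaptive_info L n g \<Longrightarrow> dist (G f) (G g) < \<epsilon>"
    using assms unfolding separates_def by blast
  define \<Psi> where "\<Psi> ys = G (SOME f. adaptive_info L n f = ys)" for ys
  have "dist (G f) (\<Psi> (adaptive_info L n f)) < \<epsilon>" for f
    unfolding \<Psi>_def
    by (rule L(2)[OF someI[of "\<lambda>g. adaptive_info L n g = adaptive_info L n f", symmetric, OF refl]])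
  then have "dist (S f) (\<Psi> (adaptive_info L n f)) \<le> dist (S f) (G f) + \<epsilon>" for f
    by (smt (verit) dist_triangle)
  then have "ereal (dist (S f) (\<Psi> (adaptive_info L n f))) \<le>
      (SUP f. ereal (dist (S f) (G f))) + ereal \<epsilon>" for f
    by (rule order_trans[OF ereal_less_eq(3)[THEN iffD2]])
      (auto simp flip: plus_ereal.simps(1) intro!: add_right_mono SUP_upper)
  then have "(SUP f. ereal (dist (S f) (\<Psi> (adaptive_info L n f)))) \<le>
      (SUP f. ereal (dist (S f) (G f))) + ereal \<epsilon>"
    by (intro SUP_least)
  then show ?thesis
    unfolding e_cont_def using L(1) by (intro INF_lower2[of "(L, \<Psi>)"]) auto
qed

theorem theorem2:
  fixes S :: "'f::topological_space \<Rightarrow> 'y::metric_space"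
    and n :: nat
  assumes "n \<ge> 2"
  shows "e_cont S n \<le> manifold_width S (2 ^ (n - 2))"
  unfolding manifold_width_def
proof (rule INF_greatest, clarify)
  fix N :: "'f \<Rightarrow> nat \<Rightarrow> real" and \<Phi> :: "(nat \<Rightarrow> real) \<Rightarrow> 'y"
  assume N: "continuous_on UNIV N" "range N \<subseteq> Rn (2 ^ (n - 2))"
    and \<Phi>: "continuous_on (Rn (2 ^ (n - 2))) \<Phi>"
  have n: "Suc (n - 2 + 1) = n"
    using assms by simp
  \<comment> \<open>Here \<open>b\<close> is \<open>n - 2\<close> and the dimension is exactly
    \<open>2 ^ b\<close>; the tolerance is finally sent to 0.\<close>
  have "e_cont S n \<le> (SUP f. ereal (dist (S f) (\<Phi> (N f)))) + ereal \<epsilon>" if "\<epsilon> > 0" for \<epsilon>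
    using separates_manifold[OF N \<Phi> _ order_refl that] unfolding n
    by (intro e_cont_le_of_separates) simp
  then show "e_cont S n \<le> (SUP f. ereal (dist (S f) (snd (N, \<Phi>) (fst (N, \<Phi>) f))))"
    unfolding fst_conv snd_conv by (rule ereal_le_epsilon2)
qed

end
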